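(* Fix an integer $\ell\ge3$. For $n\ge4$ let $v_{n,\ell}$ be the number of coherent lattice paths of size $n$ and length $\ell$. Then there is a polynomial $p_\ell$ of degree $\ell-3$ such that $v_{n,\ell}=p_\ell(n)$ for all $n\ge\max\bigl(4,\left\lceil\tfrac23\ell+1\right\rceil\bigr)$.
   Context: A diagonal-avoiding lattice path of size $n$ (dimension 2) is a sequence of points $\boldsymbol\ell_1,\dots,\boldsymbol\ell_r\in[n]^2$ with $\boldsymbol\ell_1=(2,1)$, $\boldsymbol\ell_r\in\{(n-1,n),(n,n-1)\}$, the two coordinates of each point distinct, and consecutive points differing in exactly one coordinate, which strictly increases; its length is $r$ (the number of points). Its $i$-th enhanced step is $(a\to b;z)$ where the changing coordinate goes from $a$ to $b$ and the fixed coordinate equals $z$; $\prec$ denotes the order of steps along the path. It is a coherent lattice path if for all enhanced steps $(i\to j;a)\prec(x\to y;z)$ with $x<j$ one has $j=z$ or $x=a$. *)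

theory Defs
  imports Complex_Main "HOL-Computational_Algebra.Polynomial"
begin

definition lattice_step :: "nat \<times> nat \<Rightarrow> nat \<times> nat \<Rightarrow> bool" where
  "lattice_step p q \<longleftrightarrow>
     (fst p < fst q \<and> snd p = snd q) \<or> (fst p = fst q \<and> snd p < snd q)"

definition diag_avoiding_path :: "nat \<Rightarrow> (nat \<times> nat) list \<Rightarrow> bool" where
  "diag_avoiding_path n P \<longleftrightarrow>
     P \<noteq> [] \<and> hd P = (2, 1) \<and> last P \<in> {(n - 1, n), (n, n - 1)} \<and>
     set P \<subseteq> {1..n} \<times> {1..n} \<and> (\<forall>p \<in> set P. fst p \<noteq> snd p) \<and>
     successively lattice_step P"

text \<open>The triple \<open>(a, b, z)\<close> stands for the enhanced step written a \<open>\<rightarrow>\<close> b; z.\<close>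

definition enhanced_step :: "nat \<times> nat \<Rightarrow> nat \<times> nat \<Rightarrow> nat \<times> nat \<times> nat" where
  "enhanced_step p q =
     (if snd p = snd q then (fst p, fst q, snd p) else (snd p, snd q, fst p))"

definition enhanced_steps :: "(nat \<times> nat) list \<Rightarrow> (nat \<times> nat \<times> nat) list" where
  "enhanced_steps P = map2 enhanced_step P (tl P)"

text \<open>The order of steps along the path is the order of their positions \<open>s < t\<close> in the list.\<close>

definition coherent_path :: "nat \<Rightarrow> (nat \<times> nat) list \<Rightarrow> bool" where
  "coherent_path n P \<longleftrightarrow> diag_avoiding_path n P \<and>
     (\<forall>s t i j a x y z.
        s < t \<and> t < length (enhanced_steps P) \<and>
        enhanced_steps P ! s = (i, j, a) \<and> enhanced_steps P ! t = (x, y, z) \<and> x < j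
        \<longrightarrow> j = z \<or> x = a)"

text \<open>The set below is finite, as its elements are lists of length \<open>l\<close> over a finite set;
  hence \<open>card\<close> is the true number of elements.\<close>

definition num_coherent_paths :: "nat \<Rightarrow> nat \<Rightarrow> nat" where
  "num_coherent_paths n l = card {P. coherent_path n P \<and> length P = l}"

end

theory Submission
  imports Defs
begin

text \<open>
  A path that reaches the end must, on every run in one direction but the last, take the moving
  coordinate from below the other one to above it. Between two consecutive turning values \<open>b < x\<close>
  the run arriving at \<open>x\<close> and the run leaving \<open>b\<close> both make stops, and coherence says exactly that
  no stop of the arriving run exceeds a stop of the leaving run. Reading the values in increasing
  order, each is therefore a turning value, a stop of either run, of both, or of none, subject to a
  two-state automaton (before and after the first stop of the leaving run). Its transfer matrix
  \<open>((1 + 2X, X(1 + X)), (X, 1 + X))\<close>, with \<open>X\<close> marking the points of the path, has trace \<open>2 + 3X\<close> and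
  determinant \<open>1 + 3X + X\<^sup>2 - X\<^sup>3\<close>, so for \<open>n \<ge> 4\<close> the second difference in \<open>n\<close> satisfies
  \<open>\<Delta>\<^sup>2 v(n, \<ell>) = 3 \<Delta> v(n, \<ell> - 1) - v(n, \<ell> - 2) + v(n, \<ell> - 3)\<close>. By induction on \<open>\<ell>\<close>, \<open>v(n, \<ell>)\<close> is a
  polynomial in \<open>n\<close> for all \<open>n \<ge> 4\<close>; in the binomial basis its leading coefficients obey
  \<open>a(\<ell>) = 3 a(\<ell> - 1) - a(\<ell> - 2)\<close>, starting with 4 and 12, and hence are positive.
\<close>

section \<open>Completions of a path\<close>

definition coherent_with :: "(nat \<times> nat \<times> nat) set \<Rightarrow> nat \<Rightarrow> nat \<Rightarrow> bool" where
  "coherent_with S x z \<longleftrightarrow> (\<forall>(i, j, a) \<in> S. x < j \<longrightarrow> j = z \<or> x = a)"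

definition next_points :: "nat \<Rightarrow> nat \<times> nat \<Rightarrow> (nat \<times> nat \<times> nat) set \<Rightarrow> (nat \<times> nat) set" where
  "next_points n u S = {v \<in> {1..n} \<times> {1..n}. fst v \<noteq> snd v \<and> lattice_step u v \<and>
     coherent_with S (fst (enhanced_step u v)) (snd (snd (enhanced_step u v)))}"

text \<open>\<open>u\<close> is the last point so far, \<open>S\<close> the set of enhanced steps taken, \<open>r\<close> the number of points to come.\<close>

primrec completions :: "nat \<Rightarrow> nat \<times> nat \<Rightarrow> (nat \<times> nat \<times> nat) set \<Rightarrow> nat \<Rightarrow> nat" where
  "completions n u S 0 = (if u \<in> {(n - 1, n), (n, n - 1)} then 1 else 0)"
| "completions n u S (Suc r) =
     (\<Sum>v\<in>next_points n u S. completions n v (insert (enhanced_step u v) S) r)"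

text \<open>Without the end-point condition, and with coherence as \<open>sorted_wrt\<close>,
  appending a point only tests the new step against the earlier ones.\<close>

definition coherent_prefix :: "nat \<Rightarrow> (nat \<times> nat) list \<Rightarrow> bool" where
  "coherent_prefix n P \<longleftrightarrow> P \<noteq> [] \<and> hd P = (2, 1) \<and> set P \<subseteq> {1..n} \<times> {1..n} \<and>
     (\<forall>p\<in>set P. fst p \<noteq> snd p) \<and> successively lattice_step P \<and>
     sorted_wrt (\<lambda>(i, j, a) (x, y, z). x < j \<longrightarrow> j = z \<or> x = a) (enhanced_steps P)"

lemma coherent_path_iff_prefix:
  "coherent_path n P \<longleftrightarrow> coherent_prefix n P \<and> last P \<in> {(n - 1, n), (n, n - 1)}"
proof -
  have "(\<forall>s t i j a x y z. s < t \<and> t < length E \<and> E ! s = (i, j, a) \<and> E ! t = (x, y, z) \<and> x < j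
          \<longrightarrow> j = z \<or> x = a) \<longleftrightarrow>
        sorted_wrt (\<lambda>(i, j, a) (x, y, z). x < j \<longrightarrow> j = z \<or> x = a) E" (is "?L \<longleftrightarrow> ?R")
    for E :: "(nat \<times> nat \<times> nat) list"
  proof
    assume L: ?L
    show ?R
      unfolding sorted_wrt_iff_nth_less
    proof (intro allI impI)
      fix s t assume "s < t" "t < length E"
      then show "(case E ! s of (i, j, a) \<Rightarrow> \<lambda>(x, y, z). x < j \<longrightarrow> j = z \<or> x = a) (E ! t)"
        using L by (cases "E ! s"; cases "E ! t") simp
    qed
  next
    assume R: ?R
    show ?L
    proof (intro allI impI)
      fix s t i j a x y z
      assume *: "s < t \<and> t < length E \<and> E ! s = (i, j, a) \<and> E ! t = (x, y, z) \<and> x < j"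
      then show "j = z \<or> x = a"
        using sorted_wrt_nth_less[OF R, of s t] by simp
    qed
  qed
  then show ?thesis
    unfolding coherent_path_def diag_avoiding_path_def coherent_prefix_def by blast
qed

lemma enhanced_steps_snoc:
  "Q \<noteq> [] \<Longrightarrow> enhanced_steps (Q @ [v]) = enhanced_steps Q @ [enhanced_step (last Q) v]"
proof (induction Q)
  case (Cons a Q)
  then show ?case by (cases Q) (simp_all add: enhanced_steps_def)
qed simp

lemma coherent_prefix_snoc:
  assumes "Q \<noteq> []"
  shows "coherent_prefix n (Q @ [v]) \<longleftrightarrow>
    coherent_prefix n Q \<and> v \<in> next_points n (last Q) (set (enhanced_steps Q))"
  using assms unfolding coherent_prefix_def next_points_def coherent_with_def
  by (cases "enhanced_step (last Q) v")
    (auto simp: enhanced_steps_snoc sorted_wrt_append successively_append_iff)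

lemma coherent_prefix_appendD: "Q \<noteq> [] \<Longrightarrow> coherent_prefix n (Q @ R) \<Longrightarrow> coherent_prefix n Q"
proof (induction R rule: rev_induct)
  case (snoc v R)
  then show ?case using coherent_prefix_snoc[of "Q @ R" n v] by simp
qed simp

lemma finite_next_points: "finite (next_points n u S)"
  unfolding next_points_def by (rule finite_subset[of _ "{1..n} \<times> {1..n}"]) auto

lemma card_completions:
  assumes "coherent_prefix n Q"
  shows "card {R. length R = r \<and> coherent_path n (Q @ R)} =
    completions n (last Q) (set (enhanced_steps Q)) r"
  using assms
proof (induction r arbitrary: Q)
  case 0
  have "{R. length R = 0 \<and> coherent_path n (Q @ R)} =
    (if last Q \<in> {(n - 1, n), (n, n - 1)} then {[]} else {})"
    using 0 by (auto simp: coherent_path_iff_prefix)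
  then show ?case by simp
next
  case (Suc r)
  let ?E = "set (enhanced_steps Q)"
  let ?N = "next_points n (last Q) ?E"
  define C where "C v = {R. length R = r \<and> coherent_path n ((Q @ [v]) @ R)}" for v
  have Q: "Q \<noteq> []" using Suc.prems by (simp add: coherent_prefix_def)
  have IH: "card (C v) = completions n v (insert (enhanced_step (last Q) v) ?E) r" if "v \<in> ?N" for v
    using Suc.IH[of "Q @ [v]"] that Suc.prems
    by (simp add: C_def coherent_prefix_snoc[OF Q] enhanced_steps_snoc[OF Q])
  have fin: "finite (C v)" for v
  proof (rule finite_subset)
    show "C v \<subseteq> {R. set R \<subseteq> {1..n} \<times> {1..n} \<and> length R = r}"
      unfolding C_def coherent_path_iff_prefix coherent_prefix_def by auto
  qed (simp add: finite_lists_length_eq)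
  have "{R. length R = Suc r \<and> coherent_path n (Q @ R)} = (\<Union>v\<in>?N. Cons v ` C v)"
  proof (intro equalityI subsetI)
    fix R assume "R \<in> {R. length R = Suc r \<and> coherent_path n (Q @ R)}"
    then obtain v R' where R: "R = v # R'" "length R' = r" "coherent_path n ((Q @ [v]) @ R')"
      by (cases R) auto
    then have "coherent_prefix n (Q @ [v])"
      using coherent_prefix_appendD[of "Q @ [v]" n R'] by (auto simp: coherent_path_iff_prefix)
    then show "R \<in> (\<Union>v\<in>?N. Cons v ` C v)"
      using R by (auto simp: C_def coherent_prefix_snoc[OF Q])
  qed (auto simp: C_def)
  also have "card \<dots> = (\<Sum>v\<in>?N. card (Cons v ` C v))"
    by (rule card_UN_disjoint) (auto simp: finite_next_points fin)
  also have "\<dots> = (\<Sum>v\<in>?N. card (C v))"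
    by (intro sum.cong card_image) auto
  finally show ?case by (simp add: IH)
qed

lemma num_coherent_paths_eq_completions:
  assumes "n \<ge> 2"
  shows "num_coherent_paths n (Suc r) = completions n (2, 1) {} r"
proof -
  have pre: "coherent_prefix n [(2, 1)]"
    using assms by (simp add: coherent_prefix_def enhanced_steps_def)
  have "{P. coherent_path n P \<and> length P = Suc r} =
      Cons (2, 1) ` {R. length R = r \<and> coherent_path n ([(2, 1)] @ R)}"
  proof (intro equalityI subsetI)
    fix P assume P: "P \<in> {P. coherent_path n P \<and> length P = Suc r}"
    then show "P \<in> Cons (2, 1) ` {R. length R = r \<and> coherent_path n ([(2, 1)] @ R)}"
      by (cases P) (auto simp: coherent_path_iff_prefix coherent_prefix_def)
  qed auto
  then have "num_coherent_paths n (Suc r) = card {R. length R = r \<and> coherent_path n ([(2, 1)] @ R)}"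
    unfolding num_coherent_paths_def by (simp add: card_image)
  then show ?thesis
    using card_completions[OF pre, of r] by (simp add: enhanced_steps_def)
qed

lemma enhanced_step_swap:
  "lattice_step u v \<Longrightarrow> enhanced_step (prod.swap u) (prod.swap v) = enhanced_step u v"
  by (cases u; cases v) (auto simp: lattice_step_def enhanced_step_def)

lemma lattice_step_swap: "lattice_step (prod.swap u) (prod.swap v) \<longleftrightarrow> lattice_step u v"
  by (cases u; cases v) (auto simp: lattice_step_def)

lemma next_points_swap: "next_points n (prod.swap u) S = prod.swap ` next_points n u S"
proof -
  have *: "prod.swap v \<in> next_points n (prod.swap u) S" if "v \<in> next_points n u S" for u v
    using that lattice_step_swap[of u v] enhanced_step_swap[of u v]
    by (cases v) (auto simp: next_points_def)
  show ?thesis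
  proof (intro equalityI subsetI)
    fix v assume "v \<in> next_points n (prod.swap u) S"
    from *[OF this] show "v \<in> prod.swap ` next_points n u S"
      by (intro image_eqI[of _ _ "prod.swap v"]) simp_all
  qed (use * in blast)
qed

text \<open>Enhanced steps do not record which coordinate moves, so reflection keeps
  \<open>S\<close>. Points can thus be written with the smaller coordinate first, also after a
  crossing.\<close>

lemma completions_swap: "completions n (prod.swap u) S r = completions n u S r"
proof (induction r arbitrary: u S)
  case 0
  then show ?case by (cases u) auto
next
  case (Suc r)
  have "completions n (prod.swap u) S (Suc r) =
    (\<Sum>v\<in>next_points n u S.
       completions n (prod.swap v) (insert (enhanced_step (prod.swap u) (prod.swap v)) S) r)"
    unfolding completions.simps next_points_swap
    by (subst sum.reindex) (auto simp: inj_on_def)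
  also have "\<dots> = completions n u S (Suc r)"
    unfolding completions.simps
    by (intro sum.cong) (auto simp: Suc.IH enhanced_step_swap next_points_def)
  finally show ?case .
qed

lemma completions_Suc:
  assumes "1 \<le> p" "p < q" "q \<le> n"
  shows "completions n (p, q) S (Suc r) =
    (if coherent_with S p q then
       (\<Sum>y\<in>{p<..<q}. completions n (y, q) (insert (p, y, q) S) r) +
       (\<Sum>y\<in>{q<..n}. completions n (q, y) (insert (p, y, q) S) r) else 0) +
    (if coherent_with S q p then
       (\<Sum>y\<in>{q<..n}. completions n (p, y) (insert (q, y, p) S) r) else 0)"
proof -
  let ?g = "\<lambda>v. completions n v (insert (enhanced_step (p, q) v) S) r"
  let ?A = "(\<lambda>y. (y, q)) ` (if coherent_with S p q then {p<..<q} else {})"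
  let ?B = "(\<lambda>y. (y, q)) ` (if coherent_with S p q then {q<..n} else {})"
  let ?C = "(\<lambda>y. (p, y)) ` (if coherent_with S q p then {q<..n} else {})"
  have "next_points n (p, q) S = (?A \<union> ?B) \<union> ?C"
    using assms unfolding next_points_def
    by (auto simp: lattice_step_def enhanced_step_def image_iff)
  then have "completions n (p, q) S (Suc r) = sum ?g ((?A \<union> ?B) \<union> ?C)"
    by simp
  also have "\<dots> = sum ?g (?A \<union> ?B) + sum ?g ?C"
    using assms by (intro sum.union_disjoint) auto
  also have "sum ?g (?A \<union> ?B) = sum ?g ?A + sum ?g ?B"
    using assms by (intro sum.union_disjoint) auto
  also have "sum ?g ?A = (if coherent_with S p q then
       (\<Sum>y\<in>{p<..<q}. completions n (y, q) (insert (p, y, q) S) r) else 0)"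
    using assms by (auto simp: sum.reindex inj_on_def enhanced_step_def)
  also have "sum ?g ?B = (if coherent_with S p q then
       (\<Sum>y\<in>{q<..n}. completions n (q, y) (insert (p, y, q) S) r) else 0)"
  proof -
    have "completions n (y, q) T r = completions n (q, y) T r" for y T
      using completions_swap[of n "(q, y)" T r] by simp
    then show ?thesis
      by (auto simp: sum.reindex inj_on_def enhanced_step_def intro!: sum.cong)
  qed
  also have "sum ?g ?C = (if coherent_with S q p then
       (\<Sum>y\<in>{q<..n}. completions n (p, y) (insert (q, y, p) S) r) else 0)"
    using assms by (auto simp: sum.reindex inj_on_def enhanced_step_def intro!: sum.cong)
  finally show ?thesis by simp
qed

section \<open>Generating functions of completions\<close>

definition X :: "real poly" where "X = [:0, 1:]"

lemma coeff_X_mult [simp]: "coeff (X * p) 0 = 0" "coeff (X * p) (Suc r) = coeff p r"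
  by (simp_all add: X_def)

text \<open>The powers of the transfer matrix, applied to the boundary vector for two remaining values.\<close>

primrec phases :: "nat \<Rightarrow> real poly \<times> real poly" where
  "phases 0 = (2 * X + X\<^sup>2, 2 * X)"
| "phases (Suc m) =
     ((1 + 2 * X) * fst (phases m) + X * (1 + X) * snd (phases m),
      X * fst (phases m) + (1 + X) * snd (phases m))"

text \<open>With the larger coordinate \<open>k\<close> below \<open>n\<close>, these sum over the next point of a run that crosses it,
  and of a run that moves it further. The boundary at \<open>n\<close> makes \<open>k \<le> 1\<close> exceptional.\<close>

definition cross_gf :: "nat \<Rightarrow> real poly" where
  "cross_gf k = (if k = 0 then 0 else if k = 1 then 1 else fst (phases (k - 2)))"

definition extend_gf :: "nat \<Rightarrow> real poly" where
  "extend_gf k = (if k = 0 then 0 else if k = 1 then X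
     else fst (phases (k - 2)) + X * snd (phases (k - 2)))"

lemma cross_gf_0: "cross_gf 0 = 0"
  by (simp add: cross_gf_def)

lemma cross_gf_add_2: "cross_gf (Suc (Suc m)) = fst (phases m)"
  by (simp add: cross_gf_def)

lemma extend_gf_add_2: "extend_gf (Suc (Suc m)) = fst (phases m) + X * snd (phases m)"
  by (simp add: extend_gf_def)

text \<open>The parameters are those of \<open>upper_state\<close> and \<open>lower_state\<close> below.\<close>

definition upper_gf :: "nat \<Rightarrow> nat \<Rightarrow> nat \<Rightarrow> nat \<Rightarrow> real poly" where
  "upper_gf n b x s =
     (if x < n then X * cross_gf (n - x) * (1 + X) ^ (x - s) + X * extend_gf (n - x)
      else if b = n - 1 then 1 else X * (1 + X) ^ (n - 1 - s))"

definition lower_gf :: "nat \<Rightarrow> nat \<Rightarrow> nat \<Rightarrow> real poly" where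
  "lower_gf n y x =
     (if x < n then X * cross_gf (n - x) * (1 + X) ^ (x - 1 - y)
      else if y = n - 1 then 1 else X * (1 + X) ^ (n - 2 - y))"

text \<open>Splitting off \<open>y = Suc x\<close> leaves \<open>1 + X\<close> times the expression
  for \<open>Suc x\<close> and the smaller \<open>m\<close>: the second row of the transfer
  matrix.\<close>

lemma sum_cross_gf:
  "(\<Sum>y\<in>{x<..<x + m + 2}. X * cross_gf (x + m + 2 - y) * (1 + X) ^ (y - x - 1)) + X * (1 + X) ^ m =
   snd (phases m)"
proof (induction m arbitrary: x)
  case 0
  have "{x<..<x + 0 + 2} = {Suc x}" by auto
  then show ?case by (simp add: cross_gf_def)
next
  case (Suc m)
  have *: "{x<..<x + Suc m + 2} = insert (Suc x) {Suc x<..<Suc x + m + 2}" by auto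
  define S where "S = (\<Sum>y\<in>{Suc x<..<Suc x + m + 2}.
    X * cross_gf (Suc x + m + 2 - y) * (1 + X) ^ (y - Suc x - 1))"
  have "(\<Sum>y\<in>{Suc x<..<Suc x + m + 2}. X * cross_gf (x + Suc m + 2 - y) * (1 + X) ^ (y - x - 1)) =
     (1 + X) * S"
    unfolding sum_distrib_left S_def
  proof (rule sum.cong[OF refl])
    fix y assume y: "y \<in> {Suc x<..<Suc x + m + 2}"
    then have "y - x - 1 = Suc (y - Suc x - 1)" by auto
    then show "X * cross_gf (x + Suc m + 2 - y) * (1 + X) ^ (y - x - 1) =
      (1 + X) * (X * cross_gf (Suc x + m + 2 - y) * (1 + X) ^ (y - Suc x - 1))"
      by (simp only: power_Suc) (simp add: mult_ac)
  qed
  then have "(\<Sum>y\<in>{x<..<x + Suc m + 2}.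
      X * cross_gf (x + Suc m + 2 - y) * (1 + X) ^ (y - x - 1)) = X * fst (phases m) + (1 + X) * S"
    unfolding * by (simp add: cross_gf_add_2)
  moreover have "S = snd (phases m) - X * (1 + X) ^ m"
    using Suc.IH[of "Suc x"] by (simp only: eq_diff_eq S_def)
  ultimately show ?case by (simp add: algebra_simps)
qed

text \<open>Each application of the matrix raises \<open>fst - snd\<close> by
  \<open>X * (fst + X * snd)\<close>, which is the term split off at
  \<open>y = Suc x\<close>.\<close>

lemma sum_extend_gf:
  "(\<Sum>y\<in>{x<..<x + m + 2}. X * extend_gf (x + m + 2 - y)) = fst (phases m) - snd (phases m)"
proof (induction m arbitrary: x)
  case 0
  have "{x<..<x + 0 + 2} = {Suc x}" by auto
  then show ?case by (simp add: extend_gf_def power2_eq_square)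
next
  case (Suc m)
  have *: "{x<..<x + Suc m + 2} = insert (Suc x) {Suc x<..<Suc x + m + 2}" by auto
  show ?case
    unfolding * using Suc.IH[of "Suc x"] by (simp add: extend_gf_add_2 algebra_simps)
qed

text \<open>After an extension from \<open>x\<close> the last stop is \<open>x\<close>, so the
  exponent is \<open>y - x\<close>: one factor \<open>1 + X\<close> more than in
  \<open>sum_cross_gf\<close>.\<close>

lemma sum_upper_gf_extend:
  assumes "b < x" "x \<le> n"
  shows "(\<Sum>y\<in>{x<..n}. upper_gf n b y x) = extend_gf (n - x)"
proof -
  consider "n = x" | "n = Suc x" | m where "n = x + m + 2"
    using assms by (metis add_2_eq_Suc' add_Suc_right le_Suc_ex less_eq_nat.simps(1) nat.exhaust add_0_right)
  then show ?thesis
  proof cases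
    case 2
    then have "{x<..n} = {n}" by auto
    with 2 assms show ?thesis by (auto simp: upper_gf_def extend_gf_def)
  next
    case 3
    have *: "{x<..n} = insert n {x<..<n}" using 3 by auto
    have "(\<Sum>y\<in>{x<..<n}. upper_gf n b y x) =
      (\<Sum>y\<in>{x<..<n}. (1 + X) * (X * cross_gf (n - y) * (1 + X) ^ (y - x - 1)) + X * extend_gf (n - y))"
    proof (rule sum.cong[OF refl])
      fix y assume y: "y \<in> {x<..<n}"
      then have "y - x = Suc (y - x - 1)" by auto
      then have "(1 + X) ^ (y - x) = (1 + X) * (1 + X) ^ (y - x - 1)" by (metis power_Suc)
      with y show "upper_gf n b y x =
        (1 + X) * (X * cross_gf (n - y) * (1 + X) ^ (y - x - 1)) + X * extend_gf (n - y)"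
        by (simp add: upper_gf_def mult_ac)
    qed
    also have "\<dots> = (1 + X) * (snd (phases m) - X * (1 + X) ^ m) + (fst (phases m) - snd (phases m))"
      using sum_cross_gf[of x m] sum_extend_gf[of x m] 3
      by (simp add: sum.distrib flip: sum_distrib_left)
    finally show ?thesis
      unfolding * using 3 assms by (simp add: upper_gf_def extend_gf_def algebra_simps)
  qed (simp add: extend_gf_def)
qed

lemma sum_upper_gf_cross:
  assumes "x \<le> n"
  shows "(\<Sum>y\<in>{x<..n}. upper_gf n x y (Suc x)) = cross_gf (n - x)"
proof -
  consider "n = x" | "n = Suc x" | m where "n = x + m + 2"
    using assms by (metis add_2_eq_Suc' add_Suc_right le_Suc_ex less_eq_nat.simps(1) nat.exhaust add_0_right)
  then show ?thesis
  proof cases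
    case 2
    then have "{x<..n} = {n}" by auto
    with 2 assms show ?thesis by (auto simp: upper_gf_def cross_gf_def)
  next
    case 3
    have *: "{x<..n} = insert n {x<..<n}" using 3 by auto
    have "(\<Sum>y\<in>{x<..<n}. upper_gf n x y (Suc x)) =
      (\<Sum>y\<in>{x<..<n}. X * cross_gf (n - y) * (1 + X) ^ (y - x - 1) + X * extend_gf (n - y))"
      by (rule sum.cong) (auto simp: upper_gf_def)
    also have "\<dots> = (snd (phases m) - X * (1 + X) ^ m) + (fst (phases m) - snd (phases m))"
      using sum_cross_gf[of x m] sum_extend_gf[of x m] 3 by (simp add: sum.distrib)
    finally show ?thesis
      unfolding * using 3 assms by (simp add: upper_gf_def cross_gf_def algebra_simps)
  qed (simp add: cross_gf_def)
qed

lemma geometric_sum_X: "X * (\<Sum>i<m. (1 + X) ^ i) = (1 + X) ^ m - 1"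
  using power_diff_1_eq[of "1 + X" m] by simp

lemma sum_lower_gf:
  assumes "s \<le> x" "x \<le> n" "0 < x"
  shows "X * (\<Sum>y\<in>{s..<x}. lower_gf n y x) =
    (if x < n then X * cross_gf (n - x) * ((1 + X) ^ (x - s) - 1)
     else if s = n then 0 else X * (1 + X) ^ (n - 1 - s))"
proof (cases "x < n")
  case True
  have "(\<Sum>y\<in>{s..<x}. lower_gf n y x) = (\<Sum>i<x - s. X * cross_gf (n - x) * (1 + X) ^ i)"
    using True assms
    by (intro sum.reindex_bij_witness[of _ "\<lambda>i. x - 1 - i" "\<lambda>y. x - 1 - y"])
      (auto simp: lower_gf_def)
  then have "X * (\<Sum>y\<in>{s..<x}. lower_gf n y x) =
      X * cross_gf (n - x) * (X * (\<Sum>i<x - s. (1 + X) ^ i))"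
    by (simp add: mult_ac flip: sum_distrib_left)
  with True show ?thesis by (simp add: geometric_sum_X)
next
  case False
  show ?thesis
  proof (cases "s = n")
    case s: False
    \<comment> \<open>The value \<open>n - 1\<close> ends the path and contributes 1, cancelling the
      -1 of the geometric sum over the other values.\<close>
    have "{s..<x} = insert (n - 1) {s..<n - 1}" using False s assms by auto
    moreover have "(\<Sum>y\<in>{s..<n - 1}. lower_gf n y x) = (\<Sum>i<n - 1 - s. X * (1 + X) ^ i)"
      using False assms
      by (intro sum.reindex_bij_witness[of _ "\<lambda>i. n - 2 - i" "\<lambda>y. n - 2 - y"])
        (auto simp: lower_gf_def)
    ultimately have "(\<Sum>y\<in>{s..<x}. lower_gf n y x) = 1 + X * (\<Sum>i<n - 1 - s. (1 + X) ^ i)"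
      using False s by (simp add: lower_gf_def sum_distrib_left)
    then show ?thesis
      using False s by (simp add: geometric_sum_X)
  qed (use False assms in simp)
qed

text \<open>Splits by the next point: a stop below \<open>x\<close>, a crossing, or an extension. In
  the closed form \<open>(1 + X) ^ (x - s)\<close> freely selects the stops in
  \<open>{s..<x}\<close> before a crossing.\<close>

lemma upper_gf_eq:
  assumes "b < s" "s \<le> x" "x \<le> n" "s = x \<Longrightarrow> s = Suc b"
  shows "upper_gf n b x s = (if b = n - 1 \<and> x = n then 1 else 0) +
    X * ((\<Sum>y\<in>{s..<x}. lower_gf n y x) + (\<Sum>y\<in>{x<..n}. upper_gf n x y (Suc x)) +
      (\<Sum>y\<in>{x<..n}. upper_gf n b y x))"
proof (cases "x < n")
  case True
  have "upper_gf n b x s = X * cross_gf (n - x) * (1 + X) ^ (x - s) + X * extend_gf (n - x)"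
    using True by (simp add: upper_gf_def)
  then show ?thesis
    unfolding distrib_left using assms True
    by (simp add: sum_lower_gf sum_upper_gf_extend sum_upper_gf_cross right_diff_distrib)
next
  case False
  then have "x = n" using assms by simp
  have "upper_gf n b n s = (if b = n - 1 then 1 else X * (1 + X) ^ (n - 1 - s))"
    by (simp add: upper_gf_def)
  \<comment> \<open>By the last hypothesis \<open>s = n\<close> forces \<open>b = n - 1\<close>, so
    the exceptional cases of both closed forms coincide.\<close>
  moreover have "s = n \<longleftrightarrow> b = n - 1" using assms \<open>x = n\<close> by auto
  ultimately show ?thesis
    unfolding distrib_left using assms \<open>x = n\<close> by (simp add: sum_lower_gf)
qed

lemma lower_gf_eq:
  assumes "y < x" "x \<le> n"
  shows "lower_gf n y x = (if y = n - 1 \<and> x = n then 1 else 0) +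
    X * ((\<Sum>y'\<in>{y<..<x}. lower_gf n y' x) + (\<Sum>y'\<in>{x<..n}. upper_gf n x y' (Suc x)))"
proof -
  have *: "{y<..<x} = {Suc y..<x}" by auto
  have "X * ((\<Sum>y'\<in>{Suc y..<x}. lower_gf n y' x) + (\<Sum>y'\<in>{x<..n}. upper_gf n x y' (Suc x))) =
    (if x < n then X * cross_gf (n - x) * ((1 + X) ^ (x - Suc y) - 1)
     else if Suc y = n then 0 else X * (1 + X) ^ (n - 1 - Suc y)) + X * cross_gf (n - x)"
    unfolding distrib_left using assms by (simp add: sum_lower_gf sum_upper_gf_cross)
  then show ?thesis
    unfolding * using assms
    by (auto simp: lower_gf_def right_diff_distrib cross_gf_0 numeral_2_eq_2)
qed

section \<open>States of a coherent path\<close>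

text \<open>The coordinate that stays at \<open>p\<close> can never move again, so the path misses its end point.\<close>

lemma completions_blocked:
  assumes "1 \<le> p" "p < j" "j < q" "q \<le> n" "(i, j, a) \<in> S" "a \<noteq> p"
  shows "completions n (p, q) S r = 0"
  using assms
proof (induction r arbitrary: q S)
  case (Suc r)
  have "\<not> coherent_with S p q"
    using Suc.prems by (fastforce simp: coherent_with_def)
  moreover have "completions n (p, y) (insert (q, y, p) S) r = 0" if "y \<in> {q<..n}" for y
    using that Suc.prems by (intro Suc.IH) auto
  ultimately show ?case
    using Suc.prems by (subst completions_Suc) simp_all
qed auto

text \<open>The moving coordinate has just come to \<open>y\<close> below the other coordinate \<open>x\<close> and may go on.\<close>

definition lower_state :: "nat \<Rightarrow> nat \<Rightarrow> (nat \<times> nat \<times> nat) set \<Rightarrow> bool" where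
  "lower_state y x S \<longleftrightarrow> 1 \<le> y \<and> y < x \<and> (\<forall>i j a. (i, j, a) \<in> S \<longrightarrow> j = x \<or> j \<le> y) \<and>
     (\<exists>i a. (i, x, a) \<in> S \<and> a < y)"

text \<open>The moving coordinate has just come to \<open>x\<close> above the other coordinate \<open>b\<close>; its last stop
  strictly between \<open>b\<close> and \<open>x\<close> is \<open>s\<close>, with \<open>s = Suc b\<close> if there is none. If the path now turns,
  then a stop of the other coordinate between \<open>b\<close> and \<open>x\<close> is harmless exactly if it is at
  least \<open>s\<close>.\<close>

definition upper_state :: "nat \<Rightarrow> nat \<Rightarrow> nat \<Rightarrow> (nat \<times> nat \<times> nat) set \<Rightarrow> bool" where
  "upper_state b x s S \<longleftrightarrow> 1 \<le> b \<and> b < s \<and> s \<le> x \<and>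
     (\<forall>i j a. (i, j, a) \<in> S \<longrightarrow> a = b \<and> (j = x \<or> j \<le> s) \<or> j \<le> b) \<and>
     (s = Suc b \<or> s < x \<and> (\<exists>i. (i, s, b) \<in> S)) \<and> (x = Suc b \<or> (\<exists>i. (i, x, b) \<in> S))"

lemma lower_state_stop:
  assumes "lower_state y x S" "y < z" "z < x"
  shows "lower_state z x (insert (y, z, x) S)"
  using assms unfolding lower_state_def by fastforce

lemma lower_state_cross:
  assumes "lower_state y x S" "x < z"
  shows "upper_state x z (Suc x) (insert (y, z, x) S)"
  using assms unfolding lower_state_def upper_state_def by fastforce

lemma upper_state_extend:
  assumes "upper_state b x s S" "x < z"
  shows "upper_state b z x (insert (x, z, b) S)"
  using assms unfolding upper_state_def by fastforce

text \<open>All recorded ends except \<open>x\<close> are at most \<open>s\<close>, hence at most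
  \<open>z\<close>; the step that arrived at \<open>x\<close> beside \<open>b < z\<close> is the
  witness. If \<open>x = Suc b\<close>, there is no such \<open>z\<close>.\<close>

lemma upper_state_stop:
  assumes "upper_state b x s S" "s \<le> z" "z < x"
  shows "lower_state z x (insert (b, z, x) S)"
  using assms unfolding upper_state_def lower_state_def by fastforce

lemma upper_state_cross:
  assumes "upper_state b x s S" "x < z"
  shows "upper_state x z (Suc x) (insert (b, z, x) S)"
  using assms unfolding upper_state_def by fastforce

text \<open>The larger coordinate cannot move on: the step that reached \<open>x\<close> beside some
  \<open>a < y\<close> would then block the coordinate at \<open>y\<close> for good.\<close>

lemma completions_lower_Suc:
  assumes "lower_state y x S" "x \<le> n"
  shows "completions n (y, x) S (Suc r) =
    (\<Sum>z\<in>{y<..<x}. completions n (z, x) (insert (y, z, x) S) r) +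
    (\<Sum>z\<in>{x<..n}. completions n (x, z) (insert (y, z, x) S) r)"
proof -
  have "coherent_with S y x"
    using assms by (fastforce simp: coherent_with_def lower_state_def)
  moreover obtain i a where "(i, x, a) \<in> S" "a < y"
    using assms by (auto simp: lower_state_def)
  then have "completions n (y, z) (insert (x, z, y) S) r = 0" if "z \<in> {x<..n}" for z
    using that assms
    by (intro completions_blocked[of y x z n i a]) (auto simp: lower_state_def)
  ultimately show ?thesis
    using assms by (subst completions_Suc) (auto simp: lower_state_def)
qed

lemma completions_upper_Suc:
  assumes "upper_state b x s S" "x \<le> n"
  shows "completions n (b, x) S (Suc r) =
    (\<Sum>z\<in>{s..<x}. completions n (z, x) (insert (b, z, x) S) r) +
    (\<Sum>z\<in>{x<..n}. completions n (x, z) (insert (b, z, x) S) r) +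
    (\<Sum>z\<in>{x<..n}. completions n (b, z) (insert (x, z, b) S) r)"
proof -
  have bounds: "1 \<le> b" "b < s" "s \<le> x"
    using assms by (auto simp: upper_state_def)
  have "coherent_with S b x" "coherent_with S x b"
    using assms by (fastforce simp: coherent_with_def upper_state_def)+
  \<comment> \<open>The stop at \<open>s\<close> was made beside \<open>b\<close>, not
    \<open>z\<close>, so a coordinate halting at \<open>z < s\<close> is stuck there.\<close>
  moreover have "completions n (z, x) (insert (b, z, x) S) r = 0" if z: "z \<in> {b<..<s}" for z
  proof -
    obtain i where "(i, s, b) \<in> S" "s < x"
      using assms z by (auto simp: upper_state_def)
    then show ?thesis
      using z assms(2) bounds by (intro completions_blocked[of z s x n i b]) auto
  qed
  moreover have "{b<..<x} = {b<..<s} \<union> {s..<x}" "{b<..<s} \<inter> {s..<x} = {}"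
    using bounds by auto
  ultimately show ?thesis
    using assms(2) bounds by (subst completions_Suc) (simp_all add: sum.union_disjoint)
qed

text \<open>One induction serves both states, since each leads to the other. The history
  \<open>S\<close> matters only through the state parameters.\<close>

lemma completions_eq_coeff:
  "(\<forall>y x S. lower_state y x S \<longrightarrow> x \<le> n \<longrightarrow>
      real (completions n (y, x) S r) = coeff (lower_gf n y x) r) \<and>
   (\<forall>b x s S. upper_state b x s S \<longrightarrow> x \<le> n \<longrightarrow>
      real (completions n (b, x) S r) = coeff (upper_gf n b x s) r)"
proof (induction r)
  case 0
  show ?case
  proof (intro conjI allI impI)
    fix y x S assume "lower_state y x S" "x \<le> n"
    then show "real (completions n (y, x) S 0) = coeff (lower_gf n y x) 0"
      unfolding lower_state_def by (subst lower_gf_eq) auto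
  next
    fix b x s S assume "upper_state b x s S" "x \<le> n"
    then show "real (completions n (b, x) S 0) = coeff (upper_gf n b x s) 0"
      unfolding upper_state_def by (subst upper_gf_eq) auto
  qed
next
  case (Suc r)
  then have IH: "lower_state y x S \<Longrightarrow> x \<le> n \<Longrightarrow>
      real (completions n (y, x) S r) = coeff (lower_gf n y x) r"
    "upper_state b x s S \<Longrightarrow> x \<le> n \<Longrightarrow>
      real (completions n (b, x) S r) = coeff (upper_gf n b x s) r" for y x b s S
    by blast+
  show ?case
  proof (intro conjI allI impI)
    fix y x S assume *: "lower_state y x S" "x \<le> n"
    then have "real (completions n (y, x) S (Suc r)) =
        (\<Sum>z\<in>{y<..<x}. coeff (lower_gf n z x) r) + (\<Sum>z\<in>{x<..n}. coeff (upper_gf n x z (Suc x)) r)"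
      unfolding completions_lower_Suc[OF *] of_nat_add of_nat_sum
      by (intro arg_cong2[of _ _ _ _ "(+)"] sum.cong IH lower_state_stop lower_state_cross refl)
        auto
    then show "real (completions n (y, x) S (Suc r)) = coeff (lower_gf n y x) (Suc r)"
      using * unfolding lower_state_def by (subst lower_gf_eq) (simp_all add: coeff_sum)
  next
    fix b x s S assume *: "upper_state b x s S" "x \<le> n"
    then have "real (completions n (b, x) S (Suc r)) =
        (\<Sum>z\<in>{s..<x}. coeff (lower_gf n z x) r) + (\<Sum>z\<in>{x<..n}. coeff (upper_gf n x z (Suc x)) r) +
        (\<Sum>z\<in>{x<..n}. coeff (upper_gf n b z x) r)"
      unfolding completions_upper_Suc[OF *] of_nat_add of_nat_sum
      by (intro arg_cong2[of _ _ _ _ "(+)"] sum.cong IH upper_state_stop[of b x s]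
          upper_state_cross[of b x s] upper_state_extend[of b x s] refl) auto
    then show "real (completions n (b, x) S (Suc r)) = coeff (upper_gf n b x s) (Suc r)"
      using * unfolding upper_state_def by (subst upper_gf_eq) (auto simp: coeff_sum)
  qed
qed

text \<open>The first move crosses (\<open>fst\<close>) or extends (\<open>fst + X * snd\<close>);
  its factor \<open>X\<close> is stripped.\<close>

definition path_gf :: "nat \<Rightarrow> real poly" where
  "path_gf m = 2 * fst (phases m) + X * snd (phases m)"

lemma num_coherent_paths_eq_coeff:
  "real (num_coherent_paths (m + 4) (Suc (Suc r))) = coeff (path_gf m) r"
proof -
  have *: "m + 4 - 2 = Suc (Suc m)" by simp
  have "real (num_coherent_paths (m + 4) (Suc (Suc r))) =
      real (completions (m + 4) (1, 2) {} (Suc r))"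
    using completions_swap[of "m + 4" "(1, 2)" "{}" "Suc r"]
    by (simp add: num_coherent_paths_eq_completions)
  \<comment> \<open>The start counts as an arrival at 2 above 1 without stops;
    \<open>x = Suc b\<close> lets \<open>S\<close> be empty.\<close>
  also have "\<dots> = coeff (upper_gf (m + 4) 1 2 2) (Suc r)"
    by (rule completions_eq_coeff[THEN conjunct2, rule_format]) (auto simp: upper_state_def)
  also have "upper_gf (m + 4) 1 2 2 = X * path_gf m"
    unfolding upper_gf_def path_gf_def *
    by (simp add: cross_gf_add_2 extend_gf_add_2 distrib_left)
  finally show ?thesis by simp
qed

text \<open>Cayley-Hamilton for the transfer matrix.\<close>

lemma path_gf_Suc_Suc:
  "path_gf (Suc (Suc m)) =
     (2 + 3 * X) * path_gf (Suc m) - (1 + 3 * X + X\<^sup>2 - X ^ 3) * path_gf m"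
  by (simp add: path_gf_def power2_eq_square power3_eq_cube algebra_simps)

section \<open>Polynomial sequences in the binomial basis\<close>

text \<open>\<open>a\<close> may be 0, so \<open>d\<close> only bounds the degree. In this basis
  differences merely shift coefficients.\<close>

definition binomial_poly_seq :: "nat \<Rightarrow> real \<Rightarrow> (nat \<Rightarrow> real) \<Rightarrow> bool" where
  "binomial_poly_seq d a f \<longleftrightarrow>
     (\<exists>c. c d = a \<and> (\<forall>m. f m = (\<Sum>i\<le>d. c i * real (m choose i))))"

lemma binomial_poly_seq_add:
  assumes "binomial_poly_seq d a f" "binomial_poly_seq d b g"
  shows "binomial_poly_seq d (a + b) (\<lambda>m. f m + g m)"
proof -
  obtain c c' where "c d = a" "\<And>m. f m = (\<Sum>i\<le>d. c i * real (m choose i))"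
    "c' d = b" "\<And>m. g m = (\<Sum>i\<le>d. c' i * real (m choose i))"
    using assms by (auto simp: binomial_poly_seq_def)
  then show ?thesis
    unfolding binomial_poly_seq_def
    by (intro exI[of _ "\<lambda>i. c i + c' i"]) (simp add: distrib_right sum.distrib)
qed

lemma binomial_poly_seq_mult:
  assumes "binomial_poly_seq d a f"
  shows "binomial_poly_seq d (k * a) (\<lambda>m. k * f m)"
proof -
  obtain c where "c d = a" "\<And>m. f m = (\<Sum>i\<le>d. c i * real (m choose i))"
    using assms by (auto simp: binomial_poly_seq_def)
  then show ?thesis
    unfolding binomial_poly_seq_def
    by (intro exI[of _ "\<lambda>i. k * c i"]) (simp add: sum_distrib_left mult_ac)
qed

lemma binomial_poly_seq_lift:
  assumes "binomial_poly_seq d a f"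
  shows "binomial_poly_seq (Suc d) 0 f"
proof -
  obtain c where "\<And>m. f m = (\<Sum>i\<le>d. c i * real (m choose i))"
    using assms by (auto simp: binomial_poly_seq_def)
  then show ?thesis
    unfolding binomial_poly_seq_def by (intro exI[of _ "\<lambda>i. if i \<le> d then c i else 0"]) simp
qed

lemma binomial_poly_seq_diff:
  assumes "binomial_poly_seq (Suc d) a f"
  shows "binomial_poly_seq d a (\<lambda>m. f (Suc m) - f m)"
proof -
  obtain c where c: "c (Suc d) = a" "\<And>m. f m = (\<Sum>i\<le>Suc d. c i * real (m choose i))"
    using assms by (auto simp: binomial_poly_seq_def)
  have "f (Suc m) - f m = (\<Sum>i\<le>d. c (Suc i) * real (m choose i))" for m
    unfolding c(2) sum.atMost_Suc_shift by (simp add: algebra_simps sum.distrib)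
  then show ?thesis
    unfolding binomial_poly_seq_def using c(1) by (intro exI[of _ "\<lambda>i. c (Suc i)"]) simp
qed

lemma binomial_poly_seq_antidiff:
  assumes "binomial_poly_seq d a (\<lambda>m. f (Suc m) - f m)"
  shows "binomial_poly_seq (Suc d) a f"
proof -
  obtain c where c: "c d = a" "\<And>m. f (Suc m) - f m = (\<Sum>i\<le>d. c i * real (m choose i))"
    using assms by (auto simp: binomial_poly_seq_def)
  \<comment> \<open>Pascal's rule shifts the coefficients up by one; the free constant of summation
    is \<open>f 0\<close>.\<close>
  have "f m = (\<Sum>i\<le>Suc d. (case i of 0 \<Rightarrow> f 0 | Suc j \<Rightarrow> c j) * real (m choose i))" for m
  proof (induction m)
    case (Suc m)
    then show ?case
      using c(2)[of m] unfolding sum.atMost_Suc_shift by (simp add: algebra_simps sum.distrib)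
  next
    case 0
    show ?case unfolding sum.atMost_Suc_shift by simp
  qed
  then show ?thesis
    unfolding binomial_poly_seq_def using c(1)
    by (intro exI[of _ "\<lambda>i. case i of 0 \<Rightarrow> f 0 | Suc j \<Rightarrow> c j"]) simp
qed

lemma binomial_poly_seq_imp_poly:
  assumes "binomial_poly_seq d a f" "a \<noteq> 0"
  obtains p :: "real poly" where "p \<noteq> 0" "degree p = d" "\<And>m. f m = poly p (real m)"
proof -
  obtain c where c: "c d = a" "\<And>m. f m = (\<Sum>i\<le>d. c i * real (m choose i))"
    using assms by (auto simp: binomial_poly_seq_def)
  \<comment> \<open>Falling factorials: monic of degree \<open>i\<close>, with value
    \<open>i!\<close> times the binomial coefficient, so \<open>p\<close> gets leading coefficient
    \<open>a / fact d\<close>.\<close>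
  define q :: "nat \<Rightarrow> real poly" where "q i = (\<Prod>k<i. [:- real k, 1:])" for i
  have deg: "degree (q i) = i" for i
    unfolding q_def by (subst degree_prod_eq_sum_degree) auto
  have monic: "coeff (q i) i = 1" for i
    using lead_coeff_prod[of "\<lambda>k. [:- real k, 1:]" "{..<i}"] deg[of i] by (simp add: q_def)
  have val: "poly (q i) (real m) = fact i * real (m choose i)" for i m
    unfolding q_def poly_prod binomial_gbinomial gbinomial_prod_rev
    by (simp add: atLeast0LessThan)
  define p where "p = (\<Sum>i\<le>d. smult (c i / fact i) (q i))"
  have "coeff p d = (\<Sum>i\<le>d. if i = d then a / fact d else 0)"
    unfolding p_def coeff_sum
    by (intro sum.cong) (auto simp: c monic coeff_eq_0 deg)
  then have lead: "coeff p d \<noteq> 0" using assms by simp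
  have "degree p \<le> d"
    unfolding p_def by (intro degree_sum_le) (auto simp: deg intro: degree_smult_le[THEN le_trans])
  with lead have "degree p = d" by (simp add: le_antisym le_degree)
  moreover have "f m = poly p (real m)" for m
    by (simp add: p_def poly_sum val c)
  ultimately show ?thesis using lead that[of p] by auto
qed

section \<open>The recurrence for the number of coherent paths\<close>

lemma coeff_numeral_mult: "coeff (numeral k * p) i = numeral k * coeff p i"
  by (simp add: numeral_poly)

lemma coeff_path_gf_Suc_Suc:
  "coeff (path_gf (Suc (Suc m))) 0 - coeff (path_gf (Suc m)) 0 -
     (coeff (path_gf (Suc m)) 0 - coeff (path_gf m) 0) = 0"
  "coeff (path_gf (Suc (Suc m))) 1 - coeff (path_gf (Suc m)) 1 -
     (coeff (path_gf (Suc m)) 1 - coeff (path_gf m) 1) =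
   3 * (coeff (path_gf (Suc m)) 0 - coeff (path_gf m) 0)"
  "coeff (path_gf (Suc (Suc m))) 2 - coeff (path_gf (Suc m)) 2 -
     (coeff (path_gf (Suc m)) 2 - coeff (path_gf m) 2) =
   3 * (coeff (path_gf (Suc m)) 1 - coeff (path_gf m) 1) - coeff (path_gf m) 0"
  "coeff (path_gf (Suc (Suc m))) (r + 3) - coeff (path_gf (Suc m)) (r + 3) -
     (coeff (path_gf (Suc m)) (r + 3) - coeff (path_gf m) (r + 3)) =
   3 * (coeff (path_gf (Suc m)) (r + 2) - coeff (path_gf m) (r + 2)) -
     coeff (path_gf m) (r + 1) + coeff (path_gf m) r"
proof -
  \<comment> \<open>Nesting the powers as \<open>X * (...)\<close> lets \<open>coeff_X_mult\<close>
    read off each coefficient.\<close>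
  have *: "path_gf (Suc (Suc m)) = path_gf (Suc m) + path_gf (Suc m) - path_gf m +
    X * (path_gf (Suc m) + path_gf (Suc m) + path_gf (Suc m) - path_gf m - path_gf m - path_gf m
      - X * (path_gf m - X * path_gf m))"
    unfolding path_gf_Suc_Suc by (simp add: power2_eq_square power3_eq_cube algebra_simps)
  show "coeff (path_gf (Suc (Suc m))) 0 - coeff (path_gf (Suc m)) 0 -
     (coeff (path_gf (Suc m)) 0 - coeff (path_gf m) 0) = 0"
    "coeff (path_gf (Suc (Suc m))) 1 - coeff (path_gf (Suc m)) 1 -
     (coeff (path_gf (Suc m)) 1 - coeff (path_gf m) 1) =
     3 * (coeff (path_gf (Suc m)) 0 - coeff (path_gf m) 0)"
    "coeff (path_gf (Suc (Suc m))) 2 - coeff (path_gf (Suc m)) 2 -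
     (coeff (path_gf (Suc m)) 2 - coeff (path_gf m) 2) =
     3 * (coeff (path_gf (Suc m)) 1 - coeff (path_gf m) 1) - coeff (path_gf m) 0"
    "coeff (path_gf (Suc (Suc m))) (r + 3) - coeff (path_gf (Suc m)) (r + 3) -
     (coeff (path_gf (Suc m)) (r + 3) - coeff (path_gf m) (r + 3)) =
     3 * (coeff (path_gf (Suc m)) (r + 2) - coeff (path_gf m) (r + 2)) -
     coeff (path_gf m) (r + 1) + coeff (path_gf m) r"
    unfolding * by (simp_all add: coeff_numeral_mult eval_nat_numeral)
qed

lemma path_gf_0_1: "path_gf 0 = [:0, 4, 4:]" "path_gf (Suc 0) = [:0, 4, 16, 12, 1:]"
  by (simp_all add: path_gf_def X_def numeral_poly power2_eq_square one_pCons)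

lemma coeff_path_gf_0: "coeff (path_gf m) 0 = 0"
proof (induction m rule: induct_nat_012)
  case (ge2 m)
  then show ?case using coeff_path_gf_Suc_Suc(1)[of m] by simp
qed (simp_all add: path_gf_0_1)

lemma coeff_path_gf_1: "coeff (path_gf m) (Suc 0) = 4"
proof (induction m rule: induct_nat_012)
  case (ge2 m)
  then show ?case using coeff_path_gf_Suc_Suc(2)[of m] by (simp add: coeff_path_gf_0)
qed (simp_all add: path_gf_0_1)

lemma coeff_path_gf_2: "coeff (path_gf (Suc m)) 2 - coeff (path_gf m) 2 = 12"
proof (induction m)
  case (Suc m)
  then show ?case
    using coeff_path_gf_Suc_Suc(3)[of m] by (simp add: coeff_path_gf_0 coeff_path_gf_1)
qed (simp add: path_gf_0_1 numeral_2_eq_2)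

text \<open>The recurrence reaches back three coefficients, so three are carried along. The lowest
  has leading coefficient 0 at the padded degree \<open>r\<close> and does not affect the new one,
  \<open>3 * b - a\<close>; \<open>a \<le> b\<close> makes this at least \<open>2 * b\<close>, so
  positivity and the order persist.\<close>

lemma binomial_poly_seq_coeff_path_gf:
  "\<exists>a b. 0 < a \<and> a \<le> b \<and> binomial_poly_seq r 0 (\<lambda>m. coeff (path_gf m) r) \<and>
     binomial_poly_seq r a (\<lambda>m. coeff (path_gf m) (r + 1)) \<and>
     binomial_poly_seq (r + 1) b (\<lambda>m. coeff (path_gf m) (r + 2))"
proof (induction r)
  case 0
  have const: "binomial_poly_seq 0 c (\<lambda>m. c)" for c
    unfolding binomial_poly_seq_def by (intro exI[of _ "\<lambda>_. c"]) simp
  have "binomial_poly_seq (Suc 0) 12 (\<lambda>m. coeff (path_gf m) 2)"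
    by (rule binomial_poly_seq_antidiff) (simp add: coeff_path_gf_2 const)
  then show ?case
    using const[of 0] const[of 4] coeff_path_gf_1 coeff_path_gf_0
    by - (rule exI[of _ 4], rule exI[of _ 12], simp add: eval_nat_numeral)
next
  case (Suc r)
  then obtain a b where ab: "0 < a" "a \<le> b"
    and seqs: "binomial_poly_seq r 0 (\<lambda>m. coeff (path_gf m) r)"
      "binomial_poly_seq r a (\<lambda>m. coeff (path_gf m) (r + 1))"
      "binomial_poly_seq (Suc r) b (\<lambda>m. coeff (path_gf m) (r + 2))"
    by auto
  have "binomial_poly_seq r (3 * b + (- 1) * a + 0)
    (\<lambda>m. 3 * (coeff (path_gf (Suc m)) (r + 2) - coeff (path_gf m) (r + 2)) +
       (- 1) * coeff (path_gf m) (r + 1) + coeff (path_gf m) r)"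
    using binomial_poly_seq_add[OF binomial_poly_seq_add[OF
        binomial_poly_seq_mult[OF binomial_poly_seq_diff[OF seqs(3)]]
        binomial_poly_seq_mult[OF seqs(2)]] seqs(1)] .
  then have "binomial_poly_seq r (3 * b - a)
    (\<lambda>m. coeff (path_gf (Suc (Suc m))) (r + 3) - coeff (path_gf (Suc m)) (r + 3) -
      (coeff (path_gf (Suc m)) (r + 3) - coeff (path_gf m) (r + 3)))"
    by (simp add: coeff_path_gf_Suc_Suc(4))
  then have "binomial_poly_seq (Suc (Suc r)) (3 * b - a) (\<lambda>m. coeff (path_gf m) (r + 3))"
    by (rule binomial_poly_seq_antidiff[OF binomial_poly_seq_antidiff])
  then show ?case
    using ab seqs(3) binomial_poly_seq_lift[OF seqs(2)]
    by - (rule exI[of _ b], rule exI[of _ "3 * b - a"], simp add: numeral_eq_Suc)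
qed

theorem theorem5p7:
  fixes l :: nat
  assumes "l \<ge> 3"
  shows "\<exists>p :: real poly. p \<noteq> 0 \<and> degree p = l - 3 \<and>
           (\<forall>n :: nat. n \<ge> max 4 (nat \<lceil>2 / 3 * real l + 1\<rceil>) \<longrightarrow>
              real (num_coherent_paths n l) = poly p (real n))"
proof -
  obtain r where l: "l = r + 3"
    using le_add_diff_inverse2[OF assms, symmetric] by blast
  obtain a where "0 < a" "binomial_poly_seq r a (\<lambda>m. coeff (path_gf m) (r + 1))"
    using binomial_poly_seq_coeff_path_gf[of r] by blast
  then obtain p :: "real poly" where p: "p \<noteq> 0" "degree p = r"
    "\<And>m. coeff (path_gf m) (r + 1) = poly p (real m)"
    by (elim binomial_poly_seq_imp_poly) auto
  \<comment> \<open>Shifts from \<open>m = n - 4\<close> back to \<open>n\<close>, keeping the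
    degree.\<close>
  define q where "q = pcompose p [:- 4, 1:]"
  have "real (num_coherent_paths n l) = poly q (real n)" if "n \<ge> 4" for n
  proof -
    define m where "m = n - 4"
    with that have n: "n = m + 4" by simp
    have "real (num_coherent_paths n l) = poly p (real m)"
      using num_coherent_paths_eq_coeff[of m "r + 1"] p(3)[of m]
      by (simp add: l n numeral_3_eq_3)
    then show ?thesis by (simp add: q_def poly_pcompose n)
  qed
  moreover have "degree q = l - 3"
    using p by (simp add: q_def l degree_pcompose)
  moreover have "q \<noteq> 0"
    using p pcompose_eq_0[of p "[:- 4, 1:]"] by (auto simp: q_def)
  ultimately show ?thesis by (intro exI[of _ q]) simp
qed

end
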